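(* Let $\mathbb{F}$ be an arbitrary field and let $\mathbf{O}=\mathbf{O}(\mathbb{F})$ be the split-octonion algebra over $\mathbb{F}$. Assume that $f(y)\in\mathbb{F}[y]$ is a non-zero polynomial without constant term, and let $c\in\mathbf{O}$. Let $X\subseteq\mathbf{O}$ be the set of all solutions $x\in\mathbf{O}$ of the equation $f(x)=c$. 1. Assume $c=\gamma 1_{\mathbf{O}}$ for some $\gamma\in\mathbb{F}$. Then $$X=\{\nu 1_{\mathbf{O}}\mid \nu\in\mathbb{F},\ f(\nu)=\gamma\}\ \cup\bigcup_{\substack{\lambda,\mu\in\mathbb{F}\\ \widehat{f}(\lambda,\mu)=0\\ \mu\,\check{f}(\lambda,\mu)=\gamma}}O(\lambda,\mu).$$ 2. Assume $c\notin\mathbb{F}1_{\mathbf{O}}$. Then $x\in X$ if and only if there exist $\lambda,\mu\in\mathbb{F}$ satisfying $$\left\{\begin{array}{rcl}\lambda\,\widehat{f}(\lambda,\mu)+2\mu\,\check{f}(\lambda,\mu)&=&\mathrm{tr}(c),\\ -\mu\,\widehat{f}(\lambda,\mu)^2+\lambda\mu\,\widehat{f}(\lambda,\mu)\check{f}(\lambda,\mu)+\mu^2\,\check{f}(\lambda,\mu)^2&=&n(c),\\ \widehat{f}(\lambda,\mu)&\neq&0,\end{array}\right.$$ such that $$x=\frac{1}{\widehat{f}(\lambda,\mu)}\Big(c-\mu\,\check{f}(\lambda,\mu)1_{\mathbf{O}}\Big).$$ In this case, $\mathrm{tr}(x)=\lambda$ and $n(x)=-\mu$.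
   Context: $\mathbb{F}$ is a field (possibly finite) of arbitrary characteristic. The split-octonion algebra $\mathbf{O}=\mathbf{O}(\mathbb{F})$ is the $8$-dimensional vector space of all matrices $a=\begin{pmatrix}\alpha&\mathbf{u}\\ \mathbf{v}&\beta\end{pmatrix}$ with $\alpha,\beta\in\mathbb{F}$ and vectors $\mathbf{u},\mathbf{v}\in\mathbb{F}^3$, with multiplication $$aa'=\begin{pmatrix}\alpha\alpha'+\mathbf{u}\cdot\mathbf{v}'&\alpha\mathbf{u}'+\beta'\mathbf{u}-\mathbf{v}\times\mathbf{v}'\\ \alpha'\mathbf{v}+\beta\mathbf{v}'+\mathbf{u}\times\mathbf{u}'&\beta\beta'+\mathbf{v}\cdot\mathbf{u}'\end{pmatrix},\qquad a'=\begin{pmatrix}\alpha'&\mathbf{u}'\\ \mathbf{v}'&\beta'\end{pmatrix},$$ where $\cdot$ and $\times$ are the usual dot and cross products on $\mathbb{F}^3$. The unity $1_{\mathbf{O}}$ is the element with $\alpha=\beta=1$, $\mathbf{u}=\mathbf{v}=\mathbf{0}$. The trace is $\mathrm{tr}(a)=\alpha+\beta$ and the norm is $n(a)=\alpha\beta-\mathbf{u}\cdot\mathbf{v}$. The algebra is alternative, hence power-associative, so powers $x^k$ are well defined; for $f(y)=\alpha_ny^n+\cdots+\alpha_1y$ put $f(x)=\alpha_nx^n+\cdots+\alpha_1x\in\mathbf{O}$. $\mathrm{Aut}(\mathbf{O})$ is the group of all $\mathbb{F}$-algebra automorphisms of $\mathbf{O}$. For $\lambda,\mu\in\mathbb{F}$,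 $O(\lambda,\mu)$ denotes the $\mathrm{Aut}(\mathbf{O})$-orbit of $\begin{pmatrix}\lambda&(\mu,0,0)\\(1,0,0)&0\end{pmatrix}$. Polynomials $p_k(y,z)\in\mathbb{F}[y,z]$, $k\ge -1$, are defined by $p_{-1}=0$, $p_0=1$, $p_{k+1}=yp_k+zp_{k-1}$ for $k\ge 0$. For a non-zero polynomial without constant term $f(y)=\alpha_ny^n+\cdots+\alpha_1y\in\mathbb{F}[y]$ ($n\ge1$, $\alpha_n\ne0$), define $$\widehat{f}(y,z)=\sum_{k=1}^n\alpha_kp_{k-1}(y,z),\qquad \check{f}(y,z)=\sum_{k=1}^n\alpha_kp_{k-2}(y,z).$$ *)

theory Defs
  imports "HOL-Analysis.Analysis" "HOL-Computational_Algebra.Polynomial"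
begin

text \<open>
  The library has the dot and cross product of three-dimensional vectors over the reals only.
\<close>

definition dot3 :: "'a::field ^ 3 \<Rightarrow> 'a ^ 3 \<Rightarrow> 'a" where
  "dot3 u v = (\<Sum>i\<in>UNIV. u $ i * v $ i)"

definition cross3 :: "'a::field ^ 3 \<Rightarrow> 'a ^ 3 \<Rightarrow> 'a ^ 3" where
  "cross3 u v = vector [u $ 2 * v $ 3 - u $ 3 * v $ 2,
                        u $ 3 * v $ 1 - u $ 1 * v $ 3,
                        u $ 1 * v $ 2 - u $ 2 * v $ 1]"

text \<open>
  \<open>Oct \<alpha> u v \<beta>\<close> is the matrix with first row \<open>(\<alpha>, u)\<close> and second row \<open>(v, \<beta>)\<close>.
\<close>

datatype 'a oct = Oct (oct_a: 'a) (oct_u: "'a ^ 3") (oct_v: "'a ^ 3") (oct_b: 'a)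

instantiation oct :: (field) ab_group_add
begin

definition zero_oct :: "'a oct" where
  "0 = Oct 0 0 0 0"

definition plus_oct :: "'a oct \<Rightarrow> 'a oct \<Rightarrow> 'a oct" where
  "x + y = Oct (oct_a x + oct_a y) (oct_u x + oct_u y) (oct_v x + oct_v y) (oct_b x + oct_b y)"

definition uminus_oct :: "'a oct \<Rightarrow> 'a oct" where
  "- x = Oct (- oct_a x) (- oct_u x) (- oct_v x) (- oct_b x)"

definition minus_oct :: "'a oct \<Rightarrow> 'a oct \<Rightarrow> 'a oct" where
  "x - y = Oct (oct_a x - oct_a y) (oct_u x - oct_u y) (oct_v x - oct_v y) (oct_b x - oct_b y)"

instance
  by standard (auto simp: zero_oct_def plus_oct_def uminus_oct_def minus_oct_def oct.expand)

end

text \<open>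
  The multiplication is not associative, so only the syntactic classes are instantiated for it.
  The class \<open>power\<close> fixes the bracketing \<open>x ^ Suc k = x * x ^ k\<close>; since the algebra is
  power-associative, every other bracketing gives the same element.
\<close>

instantiation oct :: (field) "{one, times}"
begin

definition one_oct :: "'a oct" where
  "1 = Oct 1 0 0 1"

definition times_oct :: "'a oct \<Rightarrow> 'a oct \<Rightarrow> 'a oct" where
  "x * y = Oct
     (oct_a x * oct_a y + dot3 (oct_u x) (oct_v y))
     (oct_a x *s oct_u y + oct_b y *s oct_u x - cross3 (oct_v x) (oct_v y))
     (oct_a y *s oct_v x + oct_b x *s oct_v y + cross3 (oct_u x) (oct_u y))
     (oct_b x * oct_b y + dot3 (oct_v x) (oct_u y))"

instance ..

end

instance oct :: (field) power ..

definition oct_scale :: "'a::field \<Rightarrow> 'a oct \<Rightarrow> 'a oct" where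
  "oct_scale r x = Oct (r * oct_a x) (r *s oct_u x) (r *s oct_v x) (r * oct_b x)"

lemma vector_space_oct: "vector_space (oct_scale :: 'a::field \<Rightarrow> _)"
  by standard
     (simp_all add: oct_scale_def plus_oct_def vector_add_ldistrib vector_sadd_rdistrib
        vector_smult_assoc algebra_simps)

definition oct_trace :: "'a::field oct \<Rightarrow> 'a" where
  "oct_trace x = oct_a x + oct_b x"

definition oct_norm :: "'a::field oct \<Rightarrow> 'a" where
  "oct_norm x = oct_a x * oct_b x - dot3 (oct_u x) (oct_v x)"

definition oct_aut :: "('a::field oct \<Rightarrow> 'a oct) set" where
  "oct_aut = {\<phi>. bij \<phi> \<and> Vector_Spaces.linear oct_scale oct_scale \<phi> \<and>
                 (\<forall>x y. \<phi> (x * y) = \<phi> x * \<phi> y)}"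

definition oct_orbit :: "'a::field \<Rightarrow> 'a \<Rightarrow> 'a oct set" where
  "oct_orbit l m = {\<phi> (Oct l (vector [m, 0, 0]) (vector [1, 0, 0]) 0) | \<phi>. \<phi> \<in> oct_aut}"

text \<open>
  The constant coefficient is left out: the definition is meant for polynomials without
  constant term.
\<close>

definition oct_eval :: "'a::field poly \<Rightarrow> 'a oct \<Rightarrow> 'a oct" where
  "oct_eval f x = (\<Sum>k = 1..degree f. oct_scale (coeff f k) (x ^ k))"


text \<open>
  The ring \<open>F[y, z]\<close> is represented as \<open>F[y][z]\<close>: the outer variable of an \<open>'a poly poly\<close>
  is \<open>z\<close>, the inner one is \<open>y\<close>.
\<close>

abbreviation var_y :: "'a::field poly poly" where
  "var_y \<equiv> [:[:0, 1:]:]"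

abbreviation var_z :: "'a::field poly poly" where
  "var_z \<equiv> [:0, 1:]"

definition eval2 :: "'a::field poly poly \<Rightarrow> 'a \<Rightarrow> 'a \<Rightarrow> 'a" where
  "eval2 g a b = poly (poly g [:b:]) a"

lemma eval2_simps:
  "eval2 0 a b = 0" "eval2 1 a b = 1" "eval2 [:[:r:]:] a b = r"
  "eval2 var_y a b = a" "eval2 var_z a b = b"
  "eval2 (g + h) a b = eval2 g a b + eval2 h a b"
  "eval2 (g * h) a b = eval2 g a b * eval2 h a b"
  by (simp_all add: eval2_def)

text \<open>Only the indices \<open>k \<ge> -1\<close> matter; the value for \<open>k < -1\<close> is a dummy.\<close>

function pp :: "int \<Rightarrow> 'a::field poly poly" where
  "pp k = (if k < 0 then 0 else if k = 0 then 1
           else var_y * pp (k - 1) + var_z * pp (k - 2))"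
  by auto
termination
  by (relation "Wellfounded.measure (\<lambda>k. nat (k + 1))") auto

declare pp.simps [simp del]

lemma pp_rec:
  "pp (- 1) = 0" "pp 0 = 1"
  "k \<ge> 0 \<Longrightarrow> pp (k + 1) = var_y * pp k + var_z * pp (k - 1)"
  by (simp_all add: pp.simps [of "- 1"] pp.simps [of 0] pp.simps [of "k + 1"])

definition fhat :: "'a::field poly \<Rightarrow> 'a poly poly" where
  "fhat f = (\<Sum>k = 1..degree f. [:[:coeff f k:]:] * pp (int k - 1))"

definition fcheck :: "'a::field poly \<Rightarrow> 'a poly poly" where
  "fcheck f = (\<Sum>k = 1..degree f. [:[:coeff f k:]:] * pp (int k - 2))"

end

theory Submission
  imports Defs
begin

text \<open>
  Every octonion satisfies \<open>x\<^sup>2 = tr(x) x - n(x) 1\<close>, so with \<open>\<lambda> = tr(x)\<close> and \<open>\<mu> = - n(x)\<close> all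
  powers of \<open>x\<close> are combinations of \<open>x\<close> and \<open>1\<close>, and \<open>f(x) = fhat(\<lambda>, \<mu>) x + \<mu> fcheck(\<lambda>, \<mu>) 1\<close>.
  If \<open>c\<close> is not a scalar, the coefficient of \<open>x\<close> cannot vanish, so \<open>x\<close> can be solved for, and
  comparing traces and norms gives the two equations for \<open>\<lambda>\<close> and \<open>\<mu>\<close>. If \<open>c\<close> is a scalar and \<open>x\<close> is
  not, both coefficients are determined. It remains to see that every non-scalar octonion lies in
  some \<open>O(\<lambda>, \<mu>)\<close>: four explicit kinds of automorphisms (the swap of the two diagonal entries, a
  cyclic shift of the coordinates, maps from \<open>SL\<^sub>3\<close>, and transvection-like maps that move the
  diagonal) suffice to reduce it to the normal form over any field.
\<close>

section \<open>Coordinate calculus for octonions\<close>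

lemma oct_eq_iff:
  "x = y \<longleftrightarrow> oct_a x = oct_a y \<and> oct_u x = oct_u y \<and> oct_v x = oct_v y \<and> oct_b x = oct_b y"
  by (auto simp: oct.expand)

lemma oct_sel_simps [simp]:
  "oct_a 0 = 0" "oct_u 0 = 0" "oct_v 0 = 0" "oct_b 0 = 0"
  "oct_a 1 = 1" "oct_u 1 = 0" "oct_v 1 = 0" "oct_b 1 = 1"
  "oct_a (x + y) = oct_a x + oct_a y" "oct_u (x + y) = oct_u x + oct_u y"
  "oct_v (x + y) = oct_v x + oct_v y" "oct_b (x + y) = oct_b x + oct_b y"
  "oct_a (x - y) = oct_a x - oct_a y" "oct_u (x - y) = oct_u x - oct_u y"
  "oct_v (x - y) = oct_v x - oct_v y" "oct_b (x - y) = oct_b x - oct_b y"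
  "oct_a (oct_scale r x) = r * oct_a x" "oct_u (oct_scale r x) = r *s oct_u x"
  "oct_v (oct_scale r x) = r *s oct_v x" "oct_b (oct_scale r x) = r * oct_b x"
  "oct_a (x * y) = oct_a x * oct_a y + dot3 (oct_u x) (oct_v y)"
  "oct_u (x * y) = oct_a x *s oct_u y + oct_b y *s oct_u x - cross3 (oct_v x) (oct_v y)"
  "oct_v (x * y) = oct_a y *s oct_v x + oct_b x *s oct_v y + cross3 (oct_u x) (oct_u y)"
  "oct_b (x * y) = oct_b x * oct_b y + dot3 (oct_v x) (oct_u y)"
  by (simp_all add: zero_oct_def one_oct_def plus_oct_def minus_oct_def times_oct_def oct_scale_def)

lemma dot3_eq: "dot3 u v = u $ 1 * v $ 1 + u $ 2 * v $ 2 + u $ 3 * v $ 3"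
  by (simp add: dot3_def sum_3)

lemma cross3_nth [simp]:
  "cross3 u v $ 1 = u $ 2 * v $ 3 - u $ 3 * v $ 2"
  "cross3 u v $ 2 = u $ 3 * v $ 1 - u $ 1 * v $ 3"
  "cross3 u v $ 3 = u $ 1 * v $ 2 - u $ 2 * v $ 1"
  by (simp_all add: cross3_def)

text \<open>Turns an octonion identity into eight scalar identities.\<close>

lemmas oct_coord_simps = oct_eq_iff dot3_eq vec_eq_iff forall_3

lemma oct_mult_one [simp]: "1 * x = x" "x * 1 = x" for x :: "'a::field oct"
  by (simp_all add: oct_coord_simps)

section \<open>The quadratic relation and values of polynomials\<close>

lemma oct_mult_combination:
  "x * (oct_scale a x + oct_scale b 1) = oct_scale a (x * x) + oct_scale b x"
  by (simp add: oct_coord_simps algebra_simps)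

lemma oct_quadratic:
  "x * x = oct_scale (oct_trace x) x + oct_scale (- oct_norm x) 1"
  by (simp add: oct_coord_simps oct_trace_def oct_norm_def algebra_simps)

lemma oct_trace_combination:
  "oct_trace (oct_scale a x + oct_scale b 1) = a * oct_trace x + 2 * b"
  by (simp add: oct_trace_def algebra_simps)

lemma oct_norm_combination:
  "oct_norm (oct_scale a x + oct_scale b 1) = a\<^sup>2 * oct_norm x + a * b * oct_trace x + b\<^sup>2"
  by (simp add: oct_norm_def oct_trace_def dot3_eq power2_eq_square algebra_simps)

text \<open>Multiplying \<open>p x + q 1\<close> by \<open>x\<close> gives
  \<open>(l p + q) x + m p 1\<close>. The coefficient of \<open>x\<close> thus follows the recursion
  of \<open>pp\<close>, and the coefficient of \<open>1\<close> is \<open>m\<close> times the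
  preceding coefficient of \<open>x\<close>. The value \<open>pp (- 1) = 0\<close> makes this
  correct for the first power.\<close>

lemma oct_power_Suc:
  fixes x :: "'a::field oct"
  defines "l \<equiv> oct_trace x" and "m \<equiv> - oct_norm x"
  shows "x ^ Suc k = oct_scale (eval2 (pp (int k)) l m) x
                   + oct_scale (m * eval2 (pp (int k - 1)) l m) 1"
proof (induction k)
  case 0
  show ?case
    by (simp add: pp_rec eval2_simps oct_coord_simps)
next
  case (Suc k)
  have "(pp (int (Suc k)) :: 'a poly poly) = var_y * pp (int k) + var_z * pp (int k - 1)"
    using pp_rec(3)[of "int k"] by (simp add: add.commute)
  then have pp: "eval2 (pp (int (Suc k))) l m
      = l * eval2 (pp (int k)) l m + m * eval2 (pp (int k - 1)) l m"
    by (simp only: eval2_simps)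
  have "x ^ Suc (Suc k) = x * x ^ Suc k"
    by simp
  also have "\<dots> = oct_scale (eval2 (pp (int (Suc k))) l m) x
                 + oct_scale (m * eval2 (pp (int k)) l m) 1"
    unfolding Suc.IH oct_mult_combination oct_quadratic[of x] pp
    by (simp add: oct_coord_simps l_def m_def algebra_simps)
  finally show ?case
    by simp
qed

lemma oct_sel_sum [simp]:
  "oct_a (sum g A) = (\<Sum>i\<in>A. oct_a (g i))" "oct_u (sum g A) = (\<Sum>i\<in>A. oct_u (g i))"
  "oct_v (sum g A) = (\<Sum>i\<in>A. oct_v (g i))" "oct_b (sum g A) = (\<Sum>i\<in>A. oct_b (g i))"
  by (induction A rule: infinite_finite_induct; simp)+

lemma eval2_sum: "eval2 (sum g A) a b = (\<Sum>i\<in>A. eval2 (g i) a b)"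
  by (simp add: eval2_def poly_sum)

lemma eval2_fhat_fcheck:
  "eval2 (fhat f) a b = (\<Sum>k = 1..degree f. coeff f k * eval2 (pp (int k - 1)) a b)"
  "eval2 (fcheck f) a b = (\<Sum>k = 1..degree f. coeff f k * eval2 (pp (int k - 2)) a b)"
  unfolding fhat_def fcheck_def eval2_sum eval2_simps by (rule refl)+

lemma oct_eval_eq:
  fixes x :: "'a::field oct"
  defines "l \<equiv> oct_trace x" and "m \<equiv> - oct_norm x"
  shows "oct_eval f x
       = oct_scale (eval2 (fhat f) l m) x + oct_scale (m * eval2 (fcheck f) l m) 1"
proof -
  have power: "x ^ k = oct_scale (eval2 (pp (int k - 1)) l m) x
                     + oct_scale (m * eval2 (pp (int k - 2)) l m) 1" if "k \<ge> 1" for k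
    using that oct_power_Suc[of x "k - 1"] by (simp add: l_def m_def of_nat_diff)
  have "oct_eval f x = (\<Sum>k = 1..degree f. oct_scale (coeff f k)
      (oct_scale (eval2 (pp (int k - 1)) l m) x + oct_scale (m * eval2 (pp (int k - 2)) l m) 1))"
    unfolding oct_eval_def by (intro sum.cong refl) (simp add: power)
  also have "\<dots> = oct_scale (eval2 (fhat f) l m) x + oct_scale (m * eval2 (fcheck f) l m) 1"
    by (simp add: eval2_fhat_fcheck oct_coord_simps
        sum.distrib sum_distrib_left sum_distrib_right algebra_simps)
  finally show ?thesis .
qed

lemma oct_power_scalar: "oct_scale r 1 ^ k = oct_scale (r ^ k) (1 :: 'a::field oct)"
  by (induction k) (simp_all add: oct_coord_simps)

lemma oct_eval_scalar:
  assumes "coeff f 0 = 0"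
  shows "oct_eval f (oct_scale r 1) = oct_scale (poly f r) 1"
proof -
  have "poly f r = (\<Sum>k = 0..degree f. coeff f k * r ^ k)"
    by (simp add: poly_altdef atLeast0AtMost)
  also have "\<dots> = (\<Sum>k = 1..degree f. coeff f k * r ^ k)"
    using assms by (simp add: sum.atLeast_Suc_atMost)
  finally show ?thesis
    by (simp add: oct_eval_def oct_power_scalar oct_coord_simps)
qed

lemma oct_scalar_iff: "x \<in> range (\<lambda>r. oct_scale r 1) \<longleftrightarrow>
    oct_a x = oct_b x \<and> oct_u x = 0 \<and> oct_v x = 0"
  by (auto simp: oct_eq_iff)

text \<open>A non-scalar \<open>x\<close> is linearly independent of \<open>1\<close>.\<close>

lemma oct_combination_eq_scalar_iff:
  assumes "x \<notin> range (\<lambda>r. oct_scale r 1)"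
  shows "oct_scale a x + oct_scale b 1 = oct_scale g 1 \<longleftrightarrow> a = 0 \<and> b = g"
  using assms by (auto simp: oct_scalar_iff oct_eq_iff)

section \<open>Automorphisms\<close>

lemma oct_autI:
  assumes "\<And>x y. \<phi> (x + y) = \<phi> x + \<phi> y" "\<And>r x. \<phi> (oct_scale r x) = oct_scale r (\<phi> x)"
    and "\<And>x y. \<phi> (x * y) = \<phi> x * \<phi> y" "\<And>x. \<psi> (\<phi> x) = x" "\<And>x. \<phi> (\<psi> x) = x"
  shows "\<phi> \<in> oct_aut"
proof -
  have "bij \<phi>"
    using assms(4,5) by (intro o_bij[of \<psi>]) auto
  moreover have "Vector_Spaces.linear oct_scale oct_scale \<phi>"
    using assms(1,2) by (intro Vector_Spaces.linear_iff[THEN iffD2]) (simp add: vector_space_oct)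
  ultimately show ?thesis
    using assms(3) by (simp add: oct_aut_def)
qed

lemma oct_aut_props:
  assumes "\<phi> \<in> oct_aut"
  shows "bij \<phi>" "\<phi> (x + y) = \<phi> x + \<phi> y" "\<phi> (oct_scale r x) = oct_scale r (\<phi> x)"
    "\<phi> (x * y) = \<phi> x * \<phi> y"
  using assms by (auto simp: oct_aut_def Vector_Spaces.linear_iff)

lemma oct_aut_one:
  assumes "\<phi> \<in> oct_aut"
  shows "\<phi> 1 = 1"
proof -
  obtain e where e: "\<phi> e = 1"
    using oct_aut_props(1)[OF assms] by (metis bij_pointE)
  have "\<phi> e = \<phi> 1 * \<phi> e"
    using oct_aut_props(4)[OF assms, of 1 e] by simp
  then show ?thesis
    using e by simp
qed

lemma oct_aut_eval:
  assumes "\<phi> \<in> oct_aut"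
  shows "\<phi> (oct_eval f x) = oct_eval f (\<phi> x)"
proof -
  have power: "\<phi> (x ^ k) = \<phi> x ^ k" for k
    by (induction k) (simp_all add: oct_aut_one[OF assms] oct_aut_props(4)[OF assms])
  have zero: "\<phi> 0 = 0"
    using oct_aut_props(2)[OF assms, of 0 0] by simp
  have "\<phi> (sum g A) = (\<Sum>i\<in>A. \<phi> (g i))" for g :: "nat \<Rightarrow> 'a oct" and A
    by (induction A rule: infinite_finite_induct) (simp_all add: zero oct_aut_props(2)[OF assms])
  then show ?thesis
    by (simp add: oct_eval_def power oct_aut_props(3)[OF assms])
qed

lemma oct_aut_comp:
  assumes "\<phi> \<in> oct_aut" "\<psi> \<in> oct_aut"
  shows "\<phi> \<circ> \<psi> \<in> oct_aut"
  using assms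
  by (auto simp: oct_aut_def Vector_Spaces.linear_iff intro: bij_comp)

lemma oct_aut_inv:
  assumes "\<phi> \<in> oct_aut"
  shows "inv \<phi> \<in> oct_aut"
proof (rule oct_autI[where \<psi> = \<phi>])
  note b = oct_aut_props(1)[OF assms]
  have s: "\<phi> (inv \<phi> x) = x" for x
    using b by (meson bij_inv_eq_iff)
  then show "\<phi> (inv \<phi> x) = x" for x .
  show i: "inv \<phi> (\<phi> x) = x" for x
    using b by (simp add: bij_is_inj)
  show "inv \<phi> (x + y) = inv \<phi> x + inv \<phi> y" for x y
    using oct_aut_props(2)[OF assms, of "inv \<phi> x" "inv \<phi> y"] by (metis s i)
  show "inv \<phi> (oct_scale r x) = oct_scale r (inv \<phi> x)" for r x
    using oct_aut_props(3)[OF assms, of r "inv \<phi> x"] by (metis s i)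
  show "inv \<phi> (x * y) = inv \<phi> x * inv \<phi> y" for x y
    using oct_aut_props(4)[OF assms, of "inv \<phi> x" "inv \<phi> y"] by (metis s i)
qed

text \<open>The signs compensate for the opposite signs of the two cross products in the
  multiplication.\<close>

definition oct_swap :: "'a::field oct \<Rightarrow> 'a oct" where
  "oct_swap x = Oct (oct_b x) (- oct_v x) (- oct_u x) (oct_a x)"

definition oct_rot :: "'a::field oct \<Rightarrow> 'a oct" where
  "oct_rot x = (let \<rho> = \<lambda>u. vector [u $ 2, u $ 3, u $ 1]
     in Oct (oct_a x) (\<rho> (oct_u x)) (\<rho> (oct_v x)) (oct_b x))"

text \<open>
  The action of a contragredient pair of elements of \<open>SL\<^sub>3\<close>, chosen so that \<open>v = (a, b, c)\<close> with
  \<open>a \<noteq> 0\<close> is mapped to \<open>(1, 0, 0)\<close>.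
\<close>

definition oct_sl :: "'a::field \<Rightarrow> 'a \<Rightarrow> 'a \<Rightarrow> 'a oct \<Rightarrow> 'a oct" where
  "oct_sl a b c x = (let u = oct_u x; v = oct_v x in Oct (oct_a x)
     (vector [a * u $ 1 + b * u $ 2 + c * u $ 3, u $ 2, u $ 3 / a])
     (vector [v $ 1 / a, v $ 2 - b * v $ 1 / a, a * v $ 3 - c * v $ 1]) (oct_b x))"

text \<open>This is \<open>exp D\<close> for the derivation \<open>D\<close> given by the terms
  linear in \<open>w\<close>, with \<open>D^3 = 0\<close>. The quadratic term \<open>D^2 / 2\<close>
  is \<open>- t *s w\<close> in the \<open>v\<close> component, which makes sense in characteristic
  2 as well.\<close>

definition oct_delta :: "'a::field ^ 3 \<Rightarrow> 'a oct \<Rightarrow> 'a oct" where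
  "oct_delta w x = (let t = dot3 (oct_u x) w in
     Oct (oct_a x + t) (oct_u x + cross3 (oct_v x) w)
       (oct_v x + (oct_b x - oct_a x - t) *s w) (oct_b x - t))"

lemma oct_swap_aut: "oct_swap \<in> oct_aut"
  by (rule oct_autI[where \<psi> = oct_swap])
     (simp_all add: oct_swap_def oct_coord_simps algebra_simps)

lemma oct_rot_aut: "oct_rot \<in> oct_aut"
  by (rule oct_autI[where \<psi> = "\<lambda>x. oct_rot (oct_rot x)"])
     (simp_all add: oct_rot_def oct_coord_simps algebra_simps)

lemma oct_sl_aut:
  assumes "a \<noteq> 0"
  shows "oct_sl a b c \<in> oct_aut"
  by (rule oct_autI[where \<psi> = "\<lambda>x. let u = oct_u x; v = oct_v x in Oct (oct_a x)
        (vector [(u $ 1 - b * u $ 2 - c * a * u $ 3) / a, u $ 2, a * u $ 3])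
        (vector [a * v $ 1, v $ 2 + b * v $ 1, v $ 3 / a + c * v $ 1]) (oct_b x)"])
     (use assms in \<open>simp_all add: oct_sl_def Let_def oct_coord_simps field_simps\<close>)

lemma oct_delta_aut: "oct_delta w \<in> oct_aut"
  by (rule oct_autI[where \<psi> = "oct_delta (- w)"])
     (simp_all add: oct_delta_def Let_def oct_coord_simps algebra_simps)

section \<open>Reduction of non-scalar octonions to the normal form\<close>

definition oct_conj :: "'a::field oct \<Rightarrow> 'a oct \<Rightarrow> bool" where
  "oct_conj x y \<longleftrightarrow> (\<exists>\<phi>\<in>oct_aut. \<phi> x = y)"

lemma oct_conj_refl: "oct_conj x x"
  unfolding oct_conj_def by (rule bexI[of _ id]) (auto intro: oct_autI[where \<psi> = id])

lemma oct_conj_aut: "\<phi> \<in> oct_aut \<Longrightarrow> oct_conj x (\<phi> x)"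
  by (auto simp: oct_conj_def)

lemma oct_conj_trans [trans]: "oct_conj x y \<Longrightarrow> oct_conj y z \<Longrightarrow> oct_conj x z"
  unfolding oct_conj_def by (metis comp_apply oct_aut_comp)

lemma oct_conj_sym: "oct_conj x y \<Longrightarrow> oct_conj y x"
  unfolding oct_conj_def by (metis oct_aut_inv oct_aut_props(1) bij_inv_eq_iff)

lemma oct_conj_u_nonzero:
  assumes "x \<notin> range (\<lambda>r. oct_scale r 1)"
  shows "\<exists>y. oct_conj x y \<and> oct_u y \<noteq> 0"
proof -
  consider "oct_u x \<noteq> 0" | "oct_v x \<noteq> 0" | "oct_u x = 0" "oct_v x = 0" "oct_a x \<noteq> oct_b x"
    using assms by (auto simp: oct_scalar_iff)
  then show ?thesis
  proof cases
    case 1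
    then show ?thesis using oct_conj_refl by blast
  next
    case 2
    then have "oct_u (oct_swap x) \<noteq> 0" by (simp add: oct_swap_def)
    then show ?thesis using oct_conj_aut[OF oct_swap_aut] by blast
  next
    case 3
    \<comment> \<open>\<open>oct_delta\<close> creates the \<open>v\<close> component
      \<open>(oct_b x - oct_a x) *s w\<close>, and the swap moves it to \<open>u\<close>.\<close>
    then have "oct_u (oct_swap (oct_delta (vector [1, 0, 0]) x)) \<noteq> 0"
      by (simp add: oct_swap_def oct_delta_def oct_coord_simps)
    then show ?thesis
      using oct_conj_aut[OF oct_swap_aut] oct_conj_aut[OF oct_delta_aut] oct_conj_trans by blast
  qed
qed

lemma dot3_surj:
  assumes "u \<noteq> 0"
  shows "\<exists>w. dot3 u w = r"
proof -
  consider "u $ 1 \<noteq> 0" | "u $ 2 \<noteq> 0" | "u $ 3 \<noteq> 0"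
    using assms by (auto simp: vec_eq_iff forall_3)
  then show ?thesis
  proof cases
    case 1
    then show ?thesis by (intro exI[of _ "vector [r / u $ 1, 0, 0]"]) (simp add: dot3_eq)
  next
    case 2
    then show ?thesis by (intro exI[of _ "vector [0, r / u $ 2, 0]"]) (simp add: dot3_eq)
  next
    case 3
    then show ?thesis by (intro exI[of _ "vector [0, 0, r / u $ 3]"]) (simp add: dot3_eq)
  qed
qed

lemma oct_conj_a_zero:
  assumes "oct_u x \<noteq> 0"
  shows "\<exists>y. oct_conj x y \<and> oct_u y \<noteq> 0 \<and> oct_a y = 0"
proof (cases "oct_a x = 0")
  case True
  then show ?thesis using assms oct_conj_refl by blast
next
  case False
  obtain w where w: "dot3 (oct_u x) w = - oct_a x"
    using dot3_surj[OF assms] by blast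
  \<comment> \<open>The added cross product is orthogonal to \<open>w\<close>. The product with
    \<open>w\<close> is still \<open>- oct_a x\<close>, which is nonzero, so the new
    \<open>u\<close> cannot vanish.\<close>
  have "dot3 (oct_u (oct_delta w x)) w = dot3 (oct_u x) w"
    by (simp add: oct_delta_def Let_def dot3_eq algebra_simps)
  then have "oct_u (oct_delta w x) \<noteq> 0"
    using w False by (auto simp: dot3_eq)
  moreover have "oct_a (oct_delta w x) = 0"
    by (simp add: oct_delta_def w)
  ultimately show ?thesis
    using oct_conj_aut[OF oct_delta_aut] by blast
qed

text \<open>Rotations fix the diagonal, so a zero entry \<open>b\<close> obtained earlier
  survives.\<close>

lemma oct_conj_v1_nonzero:
  assumes "oct_v x \<noteq> 0"
  shows "\<exists>y. oct_conj x y \<and> oct_v y $ 1 \<noteq> 0 \<and> oct_b y = oct_b x"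
proof -
  consider "oct_v x $ 1 \<noteq> 0" | "oct_v x $ 2 \<noteq> 0" | "oct_v x $ 3 \<noteq> 0"
    using assms by (auto simp: vec_eq_iff forall_3)
  then show ?thesis
  proof cases
    case 1
    then show ?thesis using oct_conj_refl by blast
  next
    case 2
    then show ?thesis
      using oct_conj_aut[OF oct_rot_aut, of x] by (intro exI[of _ "oct_rot x"]) (simp add: oct_rot_def)
  next
    case 3
    then show ?thesis
      using oct_conj_trans[OF oct_conj_aut[OF oct_rot_aut] oct_conj_aut[OF oct_rot_aut], of x]
      by (intro exI[of _ "oct_rot (oct_rot x)"]) (simp add: oct_rot_def)
  qed
qed

text \<open>The reduction uses this twice. The last conjunct is for the second time, when
  \<open>u\<close> is already in normal form and must not be disturbed.\<close>

lemma oct_conj_v_unit: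
  assumes "oct_v x $ 1 \<noteq> 0" "oct_b x = 0"
  shows "\<exists>y. oct_conj x y \<and> oct_v y = vector [1, 0, 0] \<and> oct_b y = 0 \<and>
     (oct_v x $ 1 = 1 \<and> oct_u x = vector [m, 0, 0] \<longrightarrow> oct_u y = vector [m, 0, 0])"
  using assms oct_conj_aut[OF oct_sl_aut[OF assms(1)], of x "oct_v x $ 2" "oct_v x $ 3"]
  by (intro exI[of _ "oct_sl (oct_v x $ 1) (oct_v x $ 2) (oct_v x $ 3) x"])
     (auto simp: oct_sl_def Let_def oct_coord_simps)

lemma oct_conj_canonical:
  assumes "x \<notin> range (\<lambda>r. oct_scale r 1)"
  shows "\<exists>l m. x \<in> oct_orbit l m"
proof -
  obtain x1 where x1: "oct_conj x x1" "oct_u x1 \<noteq> 0"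
    using oct_conj_u_nonzero[OF assms] by blast
  obtain x2 where x2: "oct_conj x1 x2" "oct_u x2 \<noteq> 0" "oct_a x2 = 0"
    using oct_conj_a_zero[OF x1(2)] by blast
  \<comment> \<open>The swap carries the nonzero \<open>u\<close> to \<open>v\<close> and the zero
    entry \<open>a\<close> to \<open>b\<close>.\<close>
  obtain x3 where x3: "oct_conj x2 x3" "oct_v x3 \<noteq> 0" "oct_b x3 = 0"
    using x2(2,3) oct_conj_aut[OF oct_swap_aut, of x2] by (auto simp: oct_swap_def)
  obtain x4 where x4: "oct_conj x3 x4" "oct_v x4 $ 1 \<noteq> 0" "oct_b x4 = 0"
    using oct_conj_v1_nonzero[OF x3(2)] x3(3) by auto
  obtain x5 where x5: "oct_conj x4 x5" "oct_v x5 = vector [1, 0, 0]" "oct_b x5 = 0"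
    using oct_conj_v_unit[OF x4(2,3)] by blast
  \<comment> \<open>The vector below is chosen orthogonal to \<open>u\<close>, so that the zero diagonal entry is preserved,
     and such that adding its cross product with \<open>v = (1, 0, 0)\<close> clears \<open>u\<^sub>2\<close> and \<open>u\<^sub>3\<close>.\<close>
  define m where "m = oct_u x5 $ 1"
  define x6 where "x6 = oct_delta (vector [0, - oct_u x5 $ 3, oct_u x5 $ 2]) x5"
  have x6: "oct_conj x5 x6" "oct_v x6 $ 1 = 1" "oct_u x6 = vector [m, 0, 0]" "oct_b x6 = 0"
    using x5(2,3) unfolding x6_def
    by (auto simp: oct_conj_aut oct_delta_aut) (simp_all add: oct_delta_def m_def oct_coord_simps)
  \<comment> \<open>The preceding map may have spoiled the second and third entries of
    \<open>v\<close>; they are cleared again.\<close>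
  obtain x7 where x7: "oct_conj x6 x7" "oct_v x7 = vector [1, 0, 0]" "oct_b x7 = 0"
      "oct_u x7 = vector [m, 0, 0]"
    using oct_conj_v_unit[of x6 m] x6(2-4) by (metis one_neq_zero)
  have "oct_conj x x7"
    by (rule x1(1) x2(1) x3(1) x4(1) x5(1) x6(1) x7(1) oct_conj_trans)+
  then obtain \<phi> where "\<phi> \<in> oct_aut" "\<phi> x7 = x"
    using oct_conj_sym unfolding oct_conj_def by blast
  moreover have "x7 = Oct (oct_a x7) (vector [m, 0, 0]) (vector [1, 0, 0]) 0"
    using x7 by (simp add: oct_eq_iff)
  ultimately show ?thesis
    unfolding oct_orbit_def by (metis (mono_tags, lifting) mem_Collect_eq)
qed

section \<open>Solutions of the equation\<close>

lemma oct_eval_orbit_iff: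
  assumes "x \<in> oct_orbit l m"
  shows "oct_eval f x = oct_scale g 1 \<longleftrightarrow>
    eval2 (fhat f) l m = 0 \<and> m * eval2 (fcheck f) l m = g"
proof -
  let ?z = "Oct l (vector [m, 0, 0]) (vector [1, 0, 0]) 0"
  obtain \<phi> where \<phi>: "\<phi> \<in> oct_aut" "x = \<phi> ?z"
    using assms by (auto simp: oct_orbit_def)
  \<comment> \<open>Automorphisms commute with evaluation and fix scalars, so it suffices to test
    the representative, which is non-scalar with trace \<open>l\<close> and norm
    \<open>- m\<close>.\<close>
  have "oct_eval f x = oct_scale g 1 \<longleftrightarrow> \<phi> (oct_eval f ?z) = \<phi> (oct_scale g 1)"
    by (simp add: \<phi> oct_aut_eval oct_aut_props(3) oct_aut_one)
  also have "\<dots> \<longleftrightarrow> oct_eval f ?z = oct_scale g 1"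
    using oct_aut_props(1)[OF \<phi>(1)] by (simp add: bij_is_inj inj_eq)
  also have "oct_eval f ?z
      = oct_scale (eval2 (fhat f) l m) ?z + oct_scale (m * eval2 (fcheck f) l m) 1"
    using oct_eval_eq[of f ?z] by (simp add: oct_trace_def oct_norm_def dot3_eq)
  also have "\<dots> = oct_scale g 1 \<longleftrightarrow> eval2 (fhat f) l m = 0 \<and> m * eval2 (fcheck f) l m = g"
    by (rule oct_combination_eq_scalar_iff) (simp add: oct_scalar_iff oct_coord_simps)
  finally show ?thesis .
qed

lemma oct_eval_eq_scalar_solutions:
  assumes "coeff f 0 = 0"
  shows "{x. oct_eval f x = oct_scale g 1} = {oct_scale \<nu> 1 | \<nu>. poly f \<nu> = g} \<union>
    (\<Union>(l, m) \<in> {(l, m). eval2 (fhat f) l m = 0 \<and> m * eval2 (fcheck f) l m = g}. oct_orbit l m)"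
    (is "?X = ?S \<union> ?O")
proof (intro equalityI subsetI)
  fix x assume x: "x \<in> ?X"
  show "x \<in> ?S \<union> ?O"
  proof (cases "x \<in> range (\<lambda>r. oct_scale r 1)")
    case True
    then show ?thesis
      using x assms by (auto simp: oct_eval_scalar oct_eq_iff)
  next
    case False
    then obtain l m where "x \<in> oct_orbit l m"
      using oct_conj_canonical by blast
    then show ?thesis
      using x oct_eval_orbit_iff by fastforce
  qed
next
  fix x assume "x \<in> ?S \<union> ?O"
  then show "x \<in> ?X"
    using assms oct_eval_orbit_iff by (fastforce simp: oct_eval_scalar)
qed

text \<open>Solving for \<open>c\<close> gives \<open>c = h x + m k 1\<close>. The trace equation
  then becomes \<open>h l = h tr(x)\<close>, and with this the norm equation becomes
  \<open>h^2 (n(x) + m) = 0\<close>. Only division by \<open>h\<close> is involved, so the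
  characteristic does not matter.\<close>

lemma oct_solution_trace_norm:
  assumes "l * h + 2 * m * k = oct_trace c"
    and "- m * h\<^sup>2 + l * m * h * k + m\<^sup>2 * k\<^sup>2 = oct_norm c"
    and "h \<noteq> 0" and x: "x = oct_scale (1 / h) (c - oct_scale (m * k) 1)"
  shows "oct_trace x = l" "oct_norm x = - m"
proof -
  have c: "c = oct_scale h x + oct_scale (m * k) 1"
    using assms(3) by (simp add: x oct_coord_simps)
  have "h * l = h * oct_trace x"
    using assms(1) by (simp add: c oct_trace_combination algebra_simps)
  then show t: "oct_trace x = l"
    using assms(3) by simp
  have "h\<^sup>2 * (oct_norm x + m) = 0"
    using assms(2) by (simp add: c oct_norm_combination t power2_eq_square algebra_simps)
  then show "oct_norm x = - m"
    using assms(3) by (simp add: eq_neg_iff_add_eq_0)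
qed

theorem theorem3p3:
  fixes f :: "'a::field poly" and c :: "'a oct" and X :: "'a oct set"
  assumes f_nonzero: "f \<noteq> 0"
    and f_no_const: "coeff f 0 = 0"
    and X_eq: "X = {x. oct_eval f x = c}"
  shows
    "(\<forall>\<gamma>. c = oct_scale \<gamma> 1 \<longrightarrow>
        X = {oct_scale \<nu> 1 | \<nu>. poly f \<nu> = \<gamma>} \<union>
            (\<Union>(l, m) \<in> {(l, m). eval2 (fhat f) l m = 0 \<and> m * eval2 (fcheck f) l m = \<gamma>}.
                oct_orbit l m))
     \<and>
     (c \<notin> range (\<lambda>\<gamma>. oct_scale \<gamma> 1) \<longrightarrow>
        (\<forall>x.
          (x \<in> X \<longleftrightarrow>
            (\<exists>l m.
               l * eval2 (fhat f) l m + 2 * m * eval2 (fcheck f) l m = oct_trace c \<and>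
               - m * (eval2 (fhat f) l m)\<^sup>2 + l * m * eval2 (fhat f) l m * eval2 (fcheck f) l m
                 + m\<^sup>2 * (eval2 (fcheck f) l m)\<^sup>2 = oct_norm c \<and>
               eval2 (fhat f) l m \<noteq> 0 \<and>
               x = oct_scale (1 / eval2 (fhat f) l m)
                     (c - oct_scale (m * eval2 (fcheck f) l m) 1))) \<and>
          (\<forall>l m.
               l * eval2 (fhat f) l m + 2 * m * eval2 (fcheck f) l m = oct_trace c \<and>
               - m * (eval2 (fhat f) l m)\<^sup>2 + l * m * eval2 (fhat f) l m * eval2 (fcheck f) l m
                 + m\<^sup>2 * (eval2 (fcheck f) l m)\<^sup>2 = oct_norm c \<and>
               eval2 (fhat f) l m \<noteq> 0 \<and>
               x = oct_scale (1 / eval2 (fhat f) l m)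
                     (c - oct_scale (m * eval2 (fcheck f) l m) 1) \<longrightarrow>
               oct_trace x = l \<and> oct_norm x = - m)))"
proof (intro conjI allI impI)
  fix \<gamma> assume "c = oct_scale \<gamma> 1"
  then show "X = {oct_scale \<nu> 1 | \<nu>. poly f \<nu> = \<gamma>} \<union>
      (\<Union>(l, m) \<in> {(l, m). eval2 (fhat f) l m = 0 \<and> m * eval2 (fcheck f) l m = \<gamma>}. oct_orbit l m)"
    using oct_eval_eq_scalar_solutions[OF f_no_const] by (simp add: X_eq)
next
  fix x assume c: "c \<notin> range (\<lambda>\<gamma>. oct_scale \<gamma> 1)"
  show "x \<in> X \<longleftrightarrow> (\<exists>l m.
      l * eval2 (fhat f) l m + 2 * m * eval2 (fcheck f) l m = oct_trace c \<and>
      - m * (eval2 (fhat f) l m)\<^sup>2 + l * m * eval2 (fhat f) l m * eval2 (fcheck f) l m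
        + m\<^sup>2 * (eval2 (fcheck f) l m)\<^sup>2 = oct_norm c \<and>
      eval2 (fhat f) l m \<noteq> 0 \<and>
      x = oct_scale (1 / eval2 (fhat f) l m)
            (c - oct_scale (m * eval2 (fcheck f) l m) 1))" (is "_ \<longleftrightarrow> (\<exists>l m. ?P l m)")
  proof
    assume "x \<in> X"
    define l where "l = oct_trace x"
    define m where "m = - oct_norm x"
    define h where "h = eval2 (fhat f) l m"
    define k where "k = eval2 (fcheck f) l m"
    have c_eq: "c = oct_scale h x + oct_scale (m * k) 1"
      using \<open>x \<in> X\<close> oct_eval_eq[of f x] by (simp add: X_eq l_def m_def h_def k_def)
    \<comment> \<open>Otherwise \<open>c = m k 1\<close> would be a scalar.\<close>
    have "h \<noteq> 0"
      using c by (auto simp: c_eq oct_scalar_iff)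
    moreover have "oct_trace c = l * h + 2 * m * k"
      by (simp add: c_eq oct_trace_combination l_def)
    moreover have "oct_norm c = - m * h\<^sup>2 + l * m * h * k + m\<^sup>2 * k\<^sup>2"
      unfolding c_eq oct_norm_combination
      by (simp add: l_def m_def power2_eq_square algebra_simps)
    moreover have "x = oct_scale (1 / h) (c - oct_scale (m * k) 1)"
      using \<open>h \<noteq> 0\<close> by (simp add: c_eq oct_coord_simps)
    ultimately have "?P l m"
      unfolding h_def k_def by simp
    then show "\<exists>l m. ?P l m"
      by blast
  next
    assume "\<exists>l m. ?P l m"
    then obtain l m where P: "?P l m"
      by blast
    \<comment> \<open>The given \<open>l\<close> and \<open>m\<close> must first be identified with
      the trace and negated norm of \<open>x\<close>, since \<open>oct_eval_eq\<close> expresses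
      \<open>f(x)\<close> through the latter.\<close>
    then have "oct_trace x = l"
      by (elim conjE) (erule (3) oct_solution_trace_norm)
    moreover from P have "oct_norm x = - m"
      by (elim conjE) (erule (3) oct_solution_trace_norm)
    ultimately have "oct_eval f x
        = oct_scale (eval2 (fhat f) l m) x + oct_scale (m * eval2 (fcheck f) l m) 1"
      using oct_eval_eq[of f x] by simp
    also have "\<dots> = c"
      using P by (simp add: oct_coord_simps)
    finally show "x \<in> X"
      by (simp add: X_eq)
  qed
qed (elim conjE, erule (3) oct_solution_trace_norm)+

end
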